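(* $R_{(5,5)} \leq 0.1689325$, $R_{(6,5)} \leq 0.3451130$, and $R_{(6,6)} \leq \frac{5}{59}$.
   Context: For integers $b \geq k$ and $n$, a $(b,k)$-hash code of length $n$ is a subset $\mathcal{C} \subseteq \{1,2,\ldots,b\}^n$ such that for any $k$ distinct elements of $\mathcal{C}$ there is a coordinate $i \in \{1,\ldots,n\}$ in which their $i$-th entries are pairwise distinct. Let $N_{(b,k)}(n)$ denote the maximum size of a $(b,k)$-hash code of length $n$, and define $R_{(b,k)} = \limsup_{n\to\infty} \frac{1}{n}\log_2 N_{(b,k)}(n)$. *)

theory Defs
  imports "HOL-Analysis.Analysis" "HOL-Library.Liminf_Limsup"
begin

definition words :: "nat \<Rightarrow> nat \<Rightarrow> nat list set" where
  "words b n = {w. length w = n \<and> set w \<subseteq> {1..b}}"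

definition hash_code :: "nat \<Rightarrow> nat \<Rightarrow> nat \<Rightarrow> nat list set \<Rightarrow> bool" where
  "hash_code b k n C \<longleftrightarrow> C \<subseteq> words b n \<and>
     (\<forall>S \<subseteq> C. card S = k \<longrightarrow> (\<exists>i<n. inj_on (\<lambda>w. w ! i) S))"

definition N_hash :: "nat \<Rightarrow> nat \<Rightarrow> nat \<Rightarrow> nat" where
  "N_hash b k n = Max {card C | C. hash_code b k n C}"

definition R_hash :: "nat \<Rightarrow> nat \<Rightarrow> ereal" where
  "R_hash b k = limsup (\<lambda>n. ereal (log 2 (real (N_hash b k n)) / real n))"

end

theory Submission
  imports Defs "HOL-Real_Asymp.Real_Asymp"
begin

text \<open>
  Let \<open>m = k - 2\<close>. Any \<open>m\<close> distinct words of a \<open>(b,k)\<close>-hash code \<open>C\<close> give, by Hansel's argument, an upper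
  bound on \<open>log |C|\<close> by the numbers, summed over the coordinates, of further words that extend
  them to \<open>m + 1\<close> pairwise distinct symbols there. The \<open>m\<close> words are drawn from a random subcode \<open>\<Omega>\<close> in which each of the
  first \<open>l\<close> coordinates is confined to fewer than \<open>m\<close> symbols, so that these coordinates contribute
  nothing. In any other coordinate, with symbol frequencies \<open>p\<close> in \<open>\<Omega>\<close> and \<open>x\<close> in \<open>C\<close>, the contribution is
  \<open>\<Sum>\<^sub>a x\<^sub>a G\<^sub>a(p)\<close>, where \<open>G\<^sub>a(p)\<close> is \<open>m!\<close> times the \<open>m\<close>-th elementary symmetric function of the entries of
  \<open>p\<close> other than \<open>p\<^sub>a\<close>.

  The mean of \<open>p\<close> over the subcodes is \<open>x\<close>, so \<open>\<kappa> (\<langle>x,p\<rangle> - |x|\<^sup>2)\<close> may be added without changing the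
  average. For a suitable \<open>\<kappa>\<close> the resulting function is bounded pointwise by its value at the
  uniform distributions: by Newton's identities the gap is a sum of terms \<open>(p\<^sub>a - p\<^sub>b)\<^sup>2 W\<^sub>a\<^sub>b\<close> with each
  \<open>W\<^sub>a\<^sub>b \<ge> 0\<close>. Finally \<open>l\<close> is chosen as a constant fraction of the length.
\<close>

section \<open>Elementary symmetric sums\<close>

text \<open>The sum over ordered \<open>m\<close>-tuples of distinct elements of \<open>S\<close> of
  the product of their \<open>p\<close>-values, that is \<open>m!\<close> times the
  \<open>m\<close>-th elementary symmetric polynomial. The ordered form recurses on the first entry,
  as the count of tuples of words does.\<close>

fun dsum :: "('a \<Rightarrow> real) \<Rightarrow> nat \<Rightarrow> 'a set \<Rightarrow> real" where
  "dsum p 0 S = 1"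
| "dsum p (Suc m) S = (\<Sum>a\<in>S. p a * dsum p m (S - {a}))"

lemma dsum_nonneg:
  assumes "\<And>a. a \<in> S \<Longrightarrow> p a \<ge> 0"
  shows "dsum p m S \<ge> 0"
  using assms
proof (induction m arbitrary: S)
  case (Suc m)
  then show ?case by (auto intro!: sum_nonneg mult_nonneg_nonneg Suc.IH)
qed simp

lemma dsum_cong:
  assumes "\<And>a. a \<in> S \<Longrightarrow> p a = q a"
  shows "dsum p m S = dsum q m S"
  using assms
proof (induction m arbitrary: S)
  case (Suc m)
  then have "dsum p m (S - {a}) = dsum q m (S - {a})" for a
    by (intro Suc.IH) simp
  with Suc.prems show ?case by simp
qed simp

lemma dsum_scale: "dsum (\<lambda>a. c * p a) m S = c ^ m * dsum p m S"
  by (induction m arbitrary: S) (simp_all add: sum_distrib_left mult_ac)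

text \<open>A tuple either avoids \<open>a\<close> or has it in exactly one of \<open>Suc m\<close>
  positions, and its other entries then come from \<open>S - {a}\<close>.\<close>

lemma dsum_remove:
  assumes "finite S" "a \<in> S"
  shows "dsum p (Suc m) S = dsum p (Suc m) (S - {a}) + real (Suc m) * p a * dsum p m (S - {a})"
  using assms
proof (induction m arbitrary: S)
  case 0
  then show ?case by (simp add: sum.remove[of S a])
next
  case (Suc m)
  have "dsum p (Suc m) (S - {c}) =
      dsum p (Suc m) (S - {a} - {c}) + real (Suc m) * p a * dsum p m (S - {a} - {c})"
    if "c \<in> S - {a}" for c
  proof -
    have "S - {c} - {a} = S - {a} - {c}" by blast
    then show ?thesis using Suc.IH[of "S - {c}"] Suc.prems that by (auto simp del: dsum.simps)
  qed
  then have "(\<Sum>c\<in>S - {a}. p c * dsum p (Suc m) (S - {c})) =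
      (\<Sum>c\<in>S - {a}. p c * dsum p (Suc m) (S - {a} - {c})
         + real (Suc m) * p a * (p c * dsum p m (S - {a} - {c})))"
    by (intro sum.cong) (auto simp: algebra_simps simp del: dsum.simps)
  also have "\<dots> = dsum p (Suc (Suc m)) (S - {a}) + real (Suc m) * p a * dsum p (Suc m) (S - {a})"
    by (simp add: sum.distrib sum_distrib_left)
  finally have *: "(\<Sum>c\<in>S - {a}. p c * dsum p (Suc m) (S - {c})) = \<dots>" .
  have "dsum p (Suc (Suc m)) S =
      p a * dsum p (Suc m) (S - {a}) + (\<Sum>c\<in>S - {a}. p c * dsum p (Suc m) (S - {c}))"
    using Suc.prems by (subst dsum.simps) (simp add: sum.remove[of S a] del: dsum.simps)
  then show ?case unfolding * by (simp add: algebra_simps del: dsum.simps)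
qed

text \<open>One further removal reduces both sets to \<open>S - {a, b}\<close>, where the tuples
  avoiding both elements cancel.\<close>

lemma dsum_remove_diff:
  assumes "finite S" "a \<in> S" "b \<in> S"
  shows "dsum p (Suc m) (S - {a}) - dsum p (Suc m) (S - {b}) =
     real (Suc m) * (p b - p a) * dsum p m (S - {a, b})"
proof (cases "a = b")
  case False
  have "S - {a} - {b} = S - {a, b}" "S - {b} - {a} = S - {a, b}" by auto
  then show ?thesis
    using dsum_remove[of "S - {a}" b p m] dsum_remove[of "S - {b}" a p m] assms False
    by (simp add: algebra_simps del: dsum.simps)
qed simp

text \<open>A tuple of \<open>m\<close> distinct elements survives the removal of exactly those
  elements of \<open>S\<close> that lie outside it.\<close>

lemma sum_dsum_remove:
  assumes "finite S"
  shows "(\<Sum>a\<in>S. dsum p m (S - {a})) = (real (card S) - real m) * dsum p m S"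
proof (cases m)
  case (Suc k)
  have "(\<Sum>a\<in>S. dsum p m (S - {a})) =
      (\<Sum>a\<in>S. dsum p m S - real m * (p a * dsum p k (S - {a})))"
    using dsum_remove[OF assms] Suc by (intro sum.cong) (auto simp del: dsum.simps)
  also have "\<dots> = real (card S) * dsum p m S - real m * dsum p m S"
    by (simp add: sum_subtractf Suc flip: sum_distrib_left)
  finally show ?thesis by (simp add: algebra_simps)
qed simp

lemma sum_pair_diff_mult:
  fixes u v :: "'a \<Rightarrow> real"
  shows "(\<Sum>a\<in>S. \<Sum>b\<in>S. (u a - u b) * (v a - v b)) =
    2 * (real (card S) * (\<Sum>a\<in>S. u a * v a) - sum u S * sum v S)"
proof -
  have "(\<Sum>a\<in>S. \<Sum>b\<in>S. (u a - u b) * (v a - v b)) =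
      (\<Sum>a\<in>S. \<Sum>b\<in>S. u a * v a + u b * v b - u a * v b - v a * u b)"
    by (simp add: algebra_simps)
  also have "\<dots> = 2 * (real (card S) * (\<Sum>a\<in>S. u a * v a)) - sum u S * sum v S - sum v S * sum u S"
    unfolding sum.distrib sum_subtractf sum_product by (simp flip: sum_distrib_left)
  finally show ?thesis by (simp add: algebra_simps)
qed

text \<open>Chebyshev's identity \<open>sum_pair_diff_mult\<close> is applied to \<open>p\<close>
  and the sums with one element removed. Differences of the latter are multiples of
  \<open>p b - p a\<close>, so the covariance becomes a weighted sum of squares.\<close>

lemma dsum_newton:
  assumes "finite S"
  shows "real (card S) * dsum p (Suc (Suc m)) S =
    (real (card S) - real (Suc m)) * sum p S * dsum p (Suc m) S
     - real (Suc m) / 2 * (\<Sum>a\<in>S. \<Sum>b\<in>S. (p a - p b)\<^sup>2 * dsum p m (S - {a, b}))"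
proof -
  let ?G = "\<lambda>a. dsum p (Suc m) (S - {a})"
  have "(\<Sum>a\<in>S. \<Sum>b\<in>S. (p a - p b) * (?G a - ?G b)) =
     (\<Sum>a\<in>S. \<Sum>b\<in>S. - real (Suc m) * ((p a - p b)\<^sup>2 * dsum p m (S - {a, b})))"
    by (intro sum.cong refl, subst dsum_remove_diff)
       (use assms in \<open>auto simp: power2_eq_square algebra_simps simp del: dsum.simps\<close>)
  also have "\<dots> = - real (Suc m) * (\<Sum>a\<in>S. \<Sum>b\<in>S. (p a - p b)\<^sup>2 * dsum p m (S - {a, b}))"
    by (simp only: sum_distrib_left)
  finally have "2 * (real (card S) * (\<Sum>a\<in>S. p a * ?G a) - sum p S * sum ?G S) = \<dots>"
    by (simp only: sum_pair_diff_mult)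
  moreover have "(\<Sum>a\<in>S. p a * ?G a) = dsum p (Suc (Suc m)) S" by simp
  moreover note sum_dsum_remove[OF assms, of p "Suc m"]
  ultimately show ?thesis by (simp add: field_simps del: dsum.simps)
qed

lemma dsum_newton_le:
  assumes "finite S" "\<And>a. a \<in> S \<Longrightarrow> p a \<ge> 0"
  shows "real (card S) * dsum p (Suc (Suc m)) S \<le>
    (real (card S) - real (Suc m)) * sum p S * dsum p (Suc m) S"
proof -
  have "(\<Sum>a\<in>S. \<Sum>b\<in>S. (p a - p b)\<^sup>2 * dsum p m (S - {a, b})) \<ge> 0"
    using assms by (intro sum_nonneg mult_nonneg_nonneg dsum_nonneg) auto
  then show ?thesis unfolding dsum_newton[OF assms(1)] by simp
qed

text \<open>The term linear in \<open>x\<close> is completed to a square and maximised over the hyperplane \<open>sum x S = 1\<close>.\<close>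

lemma dsum_inner_le:
  assumes "finite S" "S \<noteq> {}" "sum p S = 1" "sum x S = 1" "\<kappa> > 0"
  shows "(\<Sum>a\<in>S. x a * dsum p (Suc m) (S - {a})) + \<kappa> * (\<Sum>a\<in>S. x a * p a) - \<kappa> * (\<Sum>a\<in>S. (x a)\<^sup>2)
    \<le> (real (card S) - real (Suc m)) / real (card S) * dsum p (Suc m) S
      + (\<Sum>a\<in>S. \<Sum>b\<in>S. (p a - p b)\<^sup>2 * (\<kappa> - real (Suc m) * dsum p m (S - {a, b}))\<^sup>2)
        / (8 * \<kappa> * real (card S))"
proof -
  define n where "n = real (card S)"
  have n: "n > 0" using assms by (simp add: n_def card_gt_0_iff)
  let ?G = "\<lambda>a. dsum p (Suc m) (S - {a})"
  define w where "w = (\<lambda>a. ?G a + \<kappa> * p a)"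
  have w_diff: "w a - w b = (p a - p b) * (\<kappa> - real (Suc m) * dsum p m (S - {a, b}))"
    if "a \<in> S" "b \<in> S" for a b
    using dsum_remove_diff[OF assms(1) that, of p m] by (simp add: w_def algebra_simps del: dsum.simps)
  have "(\<Sum>a\<in>S. \<Sum>b\<in>S. (p a - p b)\<^sup>2 * (\<kappa> - real (Suc m) * dsum p m (S - {a, b}))\<^sup>2) =
     (\<Sum>a\<in>S. \<Sum>b\<in>S. (w a - w b) * (w a - w b))"
    by (intro sum.cong refl) (simp add: w_diff power2_eq_square mult_ac)
  also have "\<dots> = 2 * (n * (\<Sum>a\<in>S. (w a)\<^sup>2) - (sum w S)\<^sup>2)"
    by (simp add: sum_pair_diff_mult power2_eq_square n_def)
  finally have D: "(\<Sum>a\<in>S. \<Sum>b\<in>S. (p a - p b)\<^sup>2 * (\<kappa> - real (Suc m) * dsum p m (S - {a, b}))\<^sup>2) = \<dots>" .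
  define c where "c = sum w S / n"
  have sw: "sum w S = n * c" using n by (simp add: c_def)
  \<comment> \<open>With \<open>c\<close> the mean of \<open>w\<close>, the summands all vanish
    exactly at the maximiser \<open>x a = 1 / n + (w a - c) / (2 * \<kappa>)\<close>.\<close>
  have "0 \<le> (\<Sum>a\<in>S. (w a - c - 2 * \<kappa> * (x a - 1 / n))\<^sup>2)" by (intro sum_nonneg) simp
  also have "\<dots> = (\<Sum>a\<in>S. (w a)\<^sup>2 - 4 * \<kappa> * (x a * w a) + 4 * \<kappa>\<^sup>2 * (x a)\<^sup>2
       + 2 * (2 * \<kappa> / n - c) * w a - 4 * \<kappa> * (2 * \<kappa> / n - c) * x a + (2 * \<kappa> / n - c)\<^sup>2)"
    by (intro sum.cong refl) (simp add: power2_eq_square algebra_simps)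
  also have "\<dots> = (\<Sum>a\<in>S. (w a)\<^sup>2) - 4 * \<kappa> * (\<Sum>a\<in>S. x a * w a) + 4 * \<kappa>\<^sup>2 * (\<Sum>a\<in>S. (x a)\<^sup>2)
       + 2 * (2 * \<kappa> / n - c) * (n * c) - 4 * \<kappa> * (2 * \<kappa> / n - c) + n * (2 * \<kappa> / n - c)\<^sup>2"
    by (simp add: sum.distrib sum_subtractf sum_distrib_left[symmetric] sw assms(4) n_def)
  also have "\<dots> = (\<Sum>a\<in>S. (w a)\<^sup>2) - n * c\<^sup>2 - 4 * \<kappa> * (\<Sum>a\<in>S. x a * w a)
       + 4 * \<kappa>\<^sup>2 * (\<Sum>a\<in>S. (x a)\<^sup>2) + 4 * \<kappa> * c - 4 * \<kappa>\<^sup>2 / n"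
    using n by (simp add: power2_eq_square field_simps)
  finally have "4 * \<kappa> * ((\<Sum>a\<in>S. x a * w a) - \<kappa> * (\<Sum>a\<in>S. (x a)\<^sup>2)) \<le>
      4 * \<kappa> * (c - \<kappa> / n) + ((\<Sum>a\<in>S. (w a)\<^sup>2) - n * c\<^sup>2)"
    by (simp add: power2_eq_square algebra_simps)
  also have "\<dots> = 4 * \<kappa> * (c - \<kappa> / n + ((\<Sum>a\<in>S. (w a)\<^sup>2) - n * c\<^sup>2) / (4 * \<kappa>))"
    using assms(5) by (simp add: distrib_left)
  finally have "(\<Sum>a\<in>S. x a * w a) - \<kappa> * (\<Sum>a\<in>S. (x a)\<^sup>2) \<le>
      c - \<kappa> / n + ((\<Sum>a\<in>S. (w a)\<^sup>2) - n * c\<^sup>2) / (4 * \<kappa>)"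
    using assms(5) by simp
  also have "((\<Sum>a\<in>S. (w a)\<^sup>2) - n * c\<^sup>2) / (4 * \<kappa>) =
      (2 * (n * (\<Sum>a\<in>S. (w a)\<^sup>2) - (sum w S)\<^sup>2)) / (8 * \<kappa> * n)"
    using n assms(5) by (simp add: sw power2_eq_square field_simps)
  also have "c - \<kappa> / n = (n - real (Suc m)) / n * dsum p (Suc m) S"
    using sum_dsum_remove[OF assms(1), of p "Suc m"] n assms(3)
    by (simp add: c_def w_def sum.distrib sum_distrib_left[symmetric] add_divide_distrib n_def
        del: dsum.simps)
  also have "(\<Sum>a\<in>S. x a * w a) =
      (\<Sum>a\<in>S. x a * dsum p (Suc m) (S - {a})) + \<kappa> * (\<Sum>a\<in>S. x a * p a)"
    by (simp add: w_def distrib_left sum.distrib sum_distrib_left mult_ac del: dsum.simps)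
  finally show ?thesis unfolding D n_def .
qed

lemma sum_sq_diff_mono:
  fixes p :: "'a \<Rightarrow> real"
  assumes "\<And>a b. a \<in> S \<Longrightarrow> b \<in> S \<Longrightarrow> a \<noteq> b \<Longrightarrow> f a b \<le> g a b"
  shows "(\<Sum>a\<in>S. \<Sum>b\<in>S. (p a - p b)\<^sup>2 * f a b) \<le> (\<Sum>a\<in>S. \<Sum>b\<in>S. (p a - p b)\<^sup>2 * g a b)"
proof (intro sum_mono)
  fix a b assume "a \<in> S" "b \<in> S"
  then show "(p a - p b)\<^sup>2 * f a b \<le> (p a - p b)\<^sup>2 * g a b"
    using assms[of a b] by (cases "a = b") (auto intro: mult_left_mono)
qed

section \<open>Newton's identities in degrees two to four\<close>

lemma dsum_1: "dsum p (Suc 0) S = sum p S"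
  by simp

lemma dsum_2_eq:
  assumes "finite S" "sum p S = 1"
  shows "real (card S) * dsum p 2 S =
    real (card S) - 1 - (\<Sum>a\<in>S. \<Sum>b\<in>S. (p a - p b)\<^sup>2) / 2"
  using dsum_newton[OF assms(1), of p 0] assms(2)
  unfolding dsum_1 by (simp add: numeral_2_eq_2 del: dsum.simps(2))

lemma dsum_3_eq:
  assumes "finite S" "sum p S = 1"
  shows "real (card S) * dsum p 3 S =
    (real (card S) - 2) * dsum p 2 S - (\<Sum>a\<in>S. \<Sum>b\<in>S. (p a - p b)\<^sup>2 * dsum p 1 (S - {a, b}))"
  using dsum_newton[OF assms(1), of p 1] assms(2)
  by (simp add: numeral_2_eq_2 numeral_3_eq_3 del: dsum.simps)

lemma dsum_4_eq:
  assumes "finite S" "sum p S = 1"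
  shows "real (card S) * dsum p 4 S =
    (real (card S) - 3) * dsum p 3 S
     - 3 / 2 * (\<Sum>a\<in>S. \<Sum>b\<in>S. (p a - p b)\<^sup>2 * dsum p 2 (S - {a, b}))"
  using dsum_newton[OF assms(1), of p 2] assms(2)
  by (simp add: numeral_2_eq_2 numeral_3_eq_3 eval_nat_numeral del: dsum.simps)

lemma dsum_pair_bounds:
  assumes "finite S" "sum p S = 1" "\<And>a. a \<in> S \<Longrightarrow> p a \<ge> 0" "a \<in> S" "b \<in> S" "a \<noteq> b"
  defines "T \<equiv> S - {a, b}"
  shows "dsum p m T \<ge> 0" "dsum p 1 T \<le> 1" "real (card T) = real (card S) - 2"
    "real (card T) * dsum p 2 T \<le> (real (card T) - 1) * dsum p 1 T * dsum p 1 T"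
    "real (card T) * dsum p 3 T \<le> (real (card T) - 2) * dsum p 1 T * dsum p 2 T"
proof -
  have T: "finite T" "T \<subseteq> S" "\<And>c. c \<in> T \<Longrightarrow> p c \<ge> 0" using assms by (auto simp: T_def)
  show "dsum p m T \<ge> 0" using T dsum_nonneg by blast
  show "dsum p 1 T \<le> 1"
    using sum_mono2[OF assms(1) T(2), of p] assms(2,3) by simp
  have "card S \<ge> 2"
    using card_mono[OF assms(1), of "{a, b}"] assms by simp
  moreover have "card T = card S - 2" unfolding T_def using assms by (subst card_Diff_subset) auto
  ultimately show "real (card T) = real (card S) - 2" by simp
  show "real (card T) * dsum p 2 T \<le> (real (card T) - 1) * dsum p 1 T * dsum p 1 T"
    using dsum_newton_le[OF T(1,3), where m = 0] by (simp add: numeral_2_eq_2)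
  show "real (card T) * dsum p 3 T \<le> (real (card T) - 2) * dsum p 1 T * dsum p 2 T"
    using dsum_newton_le[OF T(1,3), where m = 1] 
    by (simp add: numeral_2_eq_2 numeral_3_eq_3 del: dsum.simps(2) add: dsum_1)
qed

text \<open>A convex parabola lies below its chord over \<open>[0, G]\<close>. The bound is linear
  in \<open>g\<close>, hence comparable with the weights in Newton's identities.\<close>

lemma sq_diff_le_interpolation:
  fixes \<kappa> g G :: real
  assumes "0 \<le> g" "g \<le> G"
  shows "(\<kappa> - g)\<^sup>2 \<le> \<kappa>\<^sup>2 + g * (G - 2 * \<kappa>)"
  using mult_left_mono[OF assms(2,1)] by (simp add: power2_eq_square algebra_simps)

section \<open>Pointwise bounds for the three parameter pairs\<close>

text \<open>The right side is the value at uniform \<open>p\<close> and \<open>x\<close>. The error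
  term of \<open>dsum_inner_le\<close> is absorbed by the squares that Newton's identities subtract
  from \<open>dsum p 3 S\<close>. The two lemmas for six symbols follow the same pattern.\<close>

lemma dsum_inner_le_5_3:
  assumes "finite S" "card S = 5" "sum p S = 1" "sum x S = 1" "\<And>a. a \<in> S \<Longrightarrow> p a \<ge> 0"
  shows "(\<Sum>a\<in>S. x a * dsum p 3 (S - {a})) + 4/5 * (\<Sum>a\<in>S. x a * p a) - 4/5 * (\<Sum>a\<in>S. (x a)\<^sup>2)
    \<le> 24 / 125"
proof -
  let ?Q = "\<lambda>m a b. dsum p m (S - {a, b})"
  have "S \<noteq> {}" using assms by auto
  \<comment> \<open>The coefficients 96/125 and 64/25 are the Newton deficits 3/125 and 2/25 of
    \<open>2/5 * dsum p 3 S\<close> times the denominator 32 of the error term, so the final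
    cancellation is exact.\<close>
  have "(\<Sum>a\<in>S. \<Sum>b\<in>S. (p a - p b)\<^sup>2 * (4/5 - 3 * ?Q 2 a b)\<^sup>2) \<le>
     (\<Sum>a\<in>S. \<Sum>b\<in>S. (p a - p b)\<^sup>2 * (96/125 + 64/25 * ?Q 1 a b))"
  proof (rule sum_sq_diff_mono)
    fix a b assume ab: "a \<in> S" "b \<in> S" "a \<noteq> b"
    define q1 where "q1 = ?Q 1 a b"
    define q2 where "q2 = ?Q 2 a b"
    note B = dsum_pair_bounds[OF assms(1,3,5) ab, folded q1_def q2_def]
    have q1: "0 \<le> q1" "q1 \<le> 1" using B(1)[of 1] B(2) by (simp_all add: q1_def)
    have q2: "0 \<le> q2" using B(1)[of 2] by (simp add: q2_def)
    have "3 * q2 \<le> 2 * (q1 * q1)" using B(3,4) assms(2) by simp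
    also have "q1 * q1 \<le> q1" using q1 by (simp add: mult_left_le)
    finally have "3 * q2 \<le> 2 * q1" by simp
    then show "(4/5 - 3 * q2)\<^sup>2 \<le> 96/125 + 64/25 * q1"
      using sq_diff_le_interpolation[of "3 * q2" 2 "4/5"] q1 q2
      by (simp add: power2_eq_square)
  qed
  also have "\<dots> = 96/125 * (\<Sum>a\<in>S. \<Sum>b\<in>S. (p a - p b)\<^sup>2)
      + 64/25 * (\<Sum>a\<in>S. \<Sum>b\<in>S. (p a - p b)\<^sup>2 * ?Q 1 a b)"
    by (simp add: distrib_left sum.distrib sum_distrib_left mult_ac del: dsum.simps One_nat_def)
  finally show ?thesis
    using dsum_inner_le[OF assms(1) \<open>S \<noteq> {}\<close> assms(3,4), of "4/5" 2] dsum_2_eq[OF assms(1,3)] dsum_3_eq[OF assms(1,3)] assms(2)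
    by (simp add: eval_nat_numeral del: dsum.simps)
qed

lemma dsum_inner_le_6_3:
  assumes "finite S" "card S = 6" "sum p S = 1" "sum x S = 1" "\<And>a. a \<in> S \<Longrightarrow> p a \<ge> 0"
  shows "(\<Sum>a\<in>S. x a * dsum p 3 (S - {a})) + 1 * (\<Sum>a\<in>S. x a * p a) - 1 * (\<Sum>a\<in>S. (x a)\<^sup>2)
    \<le> 5 / 18"
proof -
  let ?Q = "\<lambda>m a b. dsum p m (S - {a, b})"
  have "S \<noteq> {}" using assms by auto
  have "(\<Sum>a\<in>S. \<Sum>b\<in>S. (p a - p b)\<^sup>2 * (1 - 3 * ?Q 2 a b)\<^sup>2) \<le>
     (\<Sum>a\<in>S. \<Sum>b\<in>S. (p a - p b)\<^sup>2 * (4/3 + 4 * ?Q 1 a b))"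
  proof (rule sum_sq_diff_mono)
    fix a b assume ab: "a \<in> S" "b \<in> S" "a \<noteq> b"
    define q1 where "q1 = ?Q 1 a b"
    define q2 where "q2 = ?Q 2 a b"
    note B = dsum_pair_bounds[OF assms(1,3,5) ab, folded q1_def q2_def]
    have q1: "0 \<le> q1" "q1 \<le> 1" using B(1)[of 1] B(2) by (simp_all add: q1_def)
    have q2: "0 \<le> q2" using B(1)[of 2] by (simp add: q2_def)
    have "4 * q2 \<le> 3 * (q1 * q1)" using B(3,4) assms(2) by simp
    also have "q1 * q1 \<le> q1" using q1 by (simp add: mult_left_le)
    finally have "4 * q2 \<le> 3 * q1" by simp
    then show "(1 - 3 * q2)\<^sup>2 \<le> 4/3 + 4 * q1"
      using sq_diff_le_interpolation[of "3 * q2" "9/4" 1] q1 q2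
      by (simp add: power2_eq_square)
  qed
  also have "\<dots> = 4/3 * (\<Sum>a\<in>S. \<Sum>b\<in>S. (p a - p b)\<^sup>2)
      + 4 * (\<Sum>a\<in>S. \<Sum>b\<in>S. (p a - p b)\<^sup>2 * ?Q 1 a b)"
    by (simp add: distrib_left sum.distrib sum_distrib_left mult_ac del: dsum.simps One_nat_def)
  finally show ?thesis
    using dsum_inner_le[OF assms(1) \<open>S \<noteq> {}\<close> assms(3,4), of "1" 2] dsum_2_eq[OF assms(1,3)] dsum_3_eq[OF assms(1,3)] assms(2)
    by (simp add: eval_nat_numeral del: dsum.simps)
qed

lemma dsum_inner_le_6_4:
  assumes "finite S" "card S = 6" "sum p S = 1" "sum x S = 1" "\<And>a. a \<in> S \<Longrightarrow> p a \<ge> 0"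
  shows "(\<Sum>a\<in>S. x a * dsum p 4 (S - {a})) + 4/9 * (\<Sum>a\<in>S. x a * p a) - 4/9 * (\<Sum>a\<in>S. (x a)\<^sup>2)
    \<le> 5 / 54"
proof -
  let ?Q = "\<lambda>m a b. dsum p m (S - {a, b})"
  have "S \<noteq> {}" using assms by auto
  \<comment> \<open>Here the constant term 16/81 equals the square of \<open>\<kappa>\<close>: there
    is no slack at a pair carrying all the mass of \<open>p\<close>.\<close>
  have "(\<Sum>a\<in>S. \<Sum>b\<in>S. (p a - p b)\<^sup>2 * (4/9 - 4 * ?Q 3 a b)\<^sup>2) \<le>
     (\<Sum>a\<in>S. \<Sum>b\<in>S. (p a - p b)\<^sup>2 * (16/81 + 16/27 * ?Q 1 a b + 16/9 * ?Q 2 a b))"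
  proof (rule sum_sq_diff_mono)
    fix a b assume ab: "a \<in> S" "b \<in> S" "a \<noteq> b"
    define q1 where "q1 = ?Q 1 a b"
    define q2 where "q2 = ?Q 2 a b"
    define q3 where "q3 = ?Q 3 a b"
    note B = dsum_pair_bounds[OF assms(1,3,5) ab, folded q1_def q2_def q3_def]
    have q1: "0 \<le> q1" "q1 \<le> 1" using B(1)[of 1] B(2) by (simp_all add: q1_def)
    have q2: "0 \<le> q2" using B(1)[of 2] by (simp add: q2_def)
    have q3: "0 \<le> q3" using B(1)[of 3] by (simp add: q3_def)
    have "4 * q2 \<le> 3 * (q1 * q1)" using B(3,4) assms(2) by simp
    also have "q1 * q1 \<le> 1" using q1 by (simp add: mult_le_one)
    finally have q2': "4 * q2 \<le> 3" by simp
    have "4 * q3 \<le> 2 * (q1 * q2)" using B(3,5) assms(2) by simp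
    also have "q1 * q2 \<le> q2" using q1 q2 by (simp add: mult_left_le_one_le)
    finally have "4 * q3 \<le> 2 * q2" by simp
    then show "(4/9 - 4 * q3)\<^sup>2 \<le> 16/81 + 16/27 * q1 + 16/9 * q2"
      using sq_diff_le_interpolation[of "4 * q3" "3/2" "4/9"] q1 q2 q3 q2'
      by (simp add: power2_eq_square)
  qed
  also have "\<dots> = 16/81 * (\<Sum>a\<in>S. \<Sum>b\<in>S. (p a - p b)\<^sup>2)
      + 16/27 * (\<Sum>a\<in>S. \<Sum>b\<in>S. (p a - p b)\<^sup>2 * ?Q 1 a b)
      + 16/9 * (\<Sum>a\<in>S. \<Sum>b\<in>S. (p a - p b)\<^sup>2 * ?Q 2 a b)"
    by (simp add: distrib_left sum.distrib sum_distrib_left mult_ac del: dsum.simps One_nat_def)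
  finally show ?thesis
    using dsum_inner_le[OF assms(1) \<open>S \<noteq> {}\<close> assms(3,4), of "4/9" 3] dsum_2_eq[OF assms(1,3)] dsum_3_eq[OF assms(1,3)]
      dsum_4_eq[OF assms(1,3)] assms(2)
    by (simp add: eval_nat_numeral del: dsum.simps)
qed

section \<open>The Hansel inequality for hash codes\<close>

text \<open>Hansel's random-colour argument: in each coordinate keep the inactive points and the active points
  of one uniformly random colour; at most one point survives all coordinates.\<close>

lemma kraft_separated:
  fixes V :: "'v set" and c :: "nat \<Rightarrow> 'v \<Rightarrow> 'c"
  assumes "finite V" "r > 0"
    and "\<And>i. i < n \<Longrightarrow> finite (K i) \<and> card (K i) = r"
    and "\<And>i y. i < n \<Longrightarrow> y \<in> V \<Longrightarrow> act i y \<Longrightarrow> c i y \<in> K i"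
    and "\<And>y z. y \<in> V \<Longrightarrow> z \<in> V \<Longrightarrow> y \<noteq> z \<Longrightarrow> \<exists>i<n. act i y \<and> act i z \<and> c i y \<noteq> c i z"
  shows "(\<Sum>y\<in>V. (1 / real r) ^ card {i. i < n \<and> act i y}) \<le> 1"
  using assms
proof (induction n arbitrary: V)
  case 0
  then have "y = z" if "y \<in> V" "z \<in> V" for y z using that by blast
  then have "card V \<le> 1" using 0 by (metis card_le_Suc0_iff_eq One_nat_def)
  then show ?case by simp
next
  case (Suc n)
  define W where "W = (\<lambda>s. {y \<in> V. \<not> act n y \<or> c n y = s})"
  define h where "h = (\<lambda>m y. (1 / real r) ^ card {i. i < m \<and> act i y})"
  have K: "finite (K n)" "card (K n) = r" using Suc.prems(3) by auto
  have IH: "(\<Sum>y\<in>W s. h n y) \<le> 1" for s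
    unfolding h_def
  proof (rule Suc.IH)
    fix y z assume "y \<in> W s" "z \<in> W s" "y \<noteq> z"
    with Suc.prems(5)[of y z] show "\<exists>i<n. act i y \<and> act i z \<and> c i y \<noteq> c i z"
      by (auto simp: W_def less_Suc_eq)
  qed (use Suc.prems in \<open>auto simp: W_def\<close>)
  \<comment> \<open>An active point survives one of the \<open>r\<close> colours and has lost a
    factor \<open>1 / r\<close>; an inactive one survives all \<open>r\<close> with its weight
    unchanged.\<close>
  have h_Suc: "(\<Sum>s\<in>K n. if y \<in> W s then h n y else 0) = real r * h (Suc n) y" if "y \<in> V" for y
  proof (cases "act n y")
    case True
    then have "{i. i < Suc n \<and> act i y} = insert n {i. i < n \<and> act i y}" by auto
    then have "h (Suc n) y = h n y / real r" by (simp add: h_def)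
    moreover have "c n y \<in> K n" using Suc.prems(4)[of n y] that True by simp
    then have "(\<Sum>s\<in>K n. if y \<in> W s then h n y else 0) = h n y"
      using True that K by (simp add: W_def sum.delta)
    ultimately show ?thesis using Suc.prems(2) by simp
  next
    case False
    then have "{i. i < Suc n \<and> act i y} = {i. i < n \<and> act i y}"
      by (auto simp: less_Suc_eq)
    then show ?thesis using False that K by (simp add: h_def W_def)
  qed
  have "real r * (\<Sum>y\<in>V. h (Suc n) y) = (\<Sum>y\<in>V. \<Sum>s\<in>K n. if y \<in> W s then h n y else 0)"
    by (simp add: h_Suc sum_distrib_left)
  also have "\<dots> = (\<Sum>s\<in>K n. \<Sum>y\<in>V. if y \<in> W s then h n y else 0)"
    by (rule sum.swap)
  also have "\<dots> = (\<Sum>s\<in>K n. \<Sum>y\<in>W s. h n y)"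
  proof (rule sum.cong[OF refl])
    fix s
    have "V \<inter> {y. y \<in> W s} = W s" by (auto simp: W_def)
    then show "(\<Sum>y\<in>V. if y \<in> W s then h n y else 0) = (\<Sum>y\<in>W s. h n y)"
      using sum.inter_restrict[OF Suc.prems(1), of "h n" "W s"] by (simp add: Int_def)
  qed
  also have "\<dots> \<le> (\<Sum>s\<in>K n. 1)" by (intro sum_mono IH)
  also have "\<dots> = real r" using K by simp
  finally show ?case using Suc.prems(2) by (simp add: h_def)
qed

text \<open>Jensen's inequality in tangent form: \<open>1 + u \<le> exp u\<close> at
  \<open>u = ln v - N y * ln r\<close>, summed over \<open>V\<close>.\<close>

lemma card_ln_le_of_kraft:
  fixes N :: "'v \<Rightarrow> nat"
  assumes "finite V" "r > 0" "(\<Sum>y\<in>V. (1 / real r) ^ N y) \<le> 1"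
  shows "real (card V) * ln (real (card V)) \<le> ln (real r) * (\<Sum>y\<in>V. real (N y))"
proof (cases "V = {}")
  case False
  define v where "v = real (card V)"
  have v: "v > 0" using False assms by (simp add: v_def card_gt_0_iff)
  have "1 + (ln v - real (N y) * ln (real r)) \<le> v * (1 / real r) ^ N y" for y
  proof -
    have "ln v - real (N y) * ln (real r) = ln (v * (1 / real r) ^ N y)"
      using v assms(2) by (simp add: ln_mult ln_realpow ln_div)
    then have "exp (ln v - real (N y) * ln (real r)) = v * (1 / real r) ^ N y"
      using v assms(2) by simp
    then show ?thesis using exp_ge_add_one_self[of "ln v - real (N y) * ln (real r)"] by simp
  qed
  then have "(\<Sum>y\<in>V. 1 + (ln v - real (N y) * ln (real r))) \<le> (\<Sum>y\<in>V. v * (1 / real r) ^ N y)"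
    by (rule sum_mono)
  also have "\<dots> = v * (\<Sum>y\<in>V. (1 / real r) ^ N y)" by (simp add: sum_distrib_left)
  also have "\<dots> \<le> v" using v assms(3) by (simp add: mult_left_le)
  finally show ?thesis
    by (simp add: sum.distrib sum_subtractf v_def[symmetric] algebra_simps sum_distrib_left)
qed simp

lemma hansel_hash_code:
  assumes "hash_code b k n C" "finite C" "k = m + 2" "m < b"
    and "length xs = m" "distinct xs" "set xs \<subseteq> C"
  shows "(real (card C) - real m) * ln (real (card C) - real m) \<le>
    ln (real (b - m)) * (\<Sum>i<n. real (card {y \<in> C. distinct (map (\<lambda>w. w ! i) (y # xs))}))"
proof -
  define V where "V = C - set xs"
  define act where "act = (\<lambda>i y. distinct (map (\<lambda>w. w ! i) (y # xs)))"
  \<comment> \<open>Where \<open>xs\<close> itself collides no word is active, and any set of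
    \<open>b - m\<close> colours serves.\<close>
  define K where "K = (\<lambda>i. if distinct (map (\<lambda>w. w ! i) xs) then {1..b} - (\<lambda>w. w ! i) ` set xs else {1..b - m})"
  have fV: "finite V" using assms by (simp add: V_def)
  have sym: "w ! i \<in> {1..b}" if "w \<in> C" "i < n" for w i
    using assms(1) that by (force simp: hash_code_def words_def)
  have K: "finite (K i) \<and> card (K i) = b - m" if "i < n" for i
  proof (cases "distinct (map (\<lambda>w. w ! i) xs)")
    case True
    then have "card ((\<lambda>w. w ! i) ` set xs) = m"
      using distinct_card[OF True] assms(5) by simp
    moreover have "(\<lambda>w. w ! i) ` set xs \<subseteq> {1..b}" using sym[OF _ that] assms(7) by blast
    ultimately show ?thesis using True by (simp add: K_def card_Diff_subset)
  qed (simp add: K_def)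
  have "(\<Sum>y\<in>V. (1 / real (b - m)) ^ card {i. i < n \<and> act i y}) \<le> 1"
  proof (rule kraft_separated[where K = K and c = "\<lambda>i y. y ! i"])
    show "y ! i \<in> K i" if "i < n" "y \<in> V" "act i y" for i y
      using that sym[of y i] by (auto simp: K_def act_def V_def)
    show "\<exists>i<n. act i y \<and> act i z \<and> y ! i \<noteq> z ! i" if "y \<in> V" "z \<in> V" "y \<noteq> z" for y z
    proof -
      have "card (set (y # z # xs)) = k"
        using that assms by (subst distinct_card) (auto simp: V_def)
      moreover have "set (y # z # xs) \<subseteq> C" using that assms by (auto simp: V_def)
      ultimately obtain i where i: "i < n" "inj_on (\<lambda>w. w ! i) (set (y # z # xs))"
        using assms(1) unfolding hash_code_def by blast
      moreover have "distinct (y # z # xs)" using that assms by (auto simp: V_def)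
      ultimately have "distinct (map (\<lambda>w. w ! i) (y # z # xs))" using distinct_map by blast
      then show ?thesis using i(1) by (auto simp: act_def)
    qed
  qed (use fV K assms in auto)
  from card_ln_le_of_kraft[OF fV _ this]
  have "real (card V) * ln (real (card V)) \<le> ln (real (b - m)) * (\<Sum>y\<in>V. real (card {i. i < n \<and> act i y}))"
    using assms by simp
  also have "(\<Sum>y\<in>V. real (card {i. i < n \<and> act i y})) = (\<Sum>y\<in>V. \<Sum>i<n. if act i y then 1 else 0)"
  proof (rule sum.cong[OF refl])
    fix y
    have "(\<Sum>i<n. if act i y then (1::real) else 0) = real (card ({..<n} \<inter> {i. act i y}))"
      by (simp add: sum.If_cases)
    also have "{..<n} \<inter> {i. act i y} = {i. i < n \<and> act i y}" by auto
    finally show "real (card {i. i < n \<and> act i y}) = (\<Sum>i<n. if act i y then 1 else 0)" by simp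
  qed
  also have "\<dots> = (\<Sum>i<n. \<Sum>y\<in>V. if act i y then 1 else 0)" by (rule sum.swap)
  \<comment> \<open>The words of \<open>xs\<close> can be put back because they repeat a symbol of
    \<open>xs\<close> and are never active.\<close>
  also have "\<dots> = (\<Sum>i<n. real (card {y \<in> C. act i y}))"
  proof (rule sum.cong[OF refl])
    fix i
    have "(\<Sum>y\<in>V. if act i y then (1::real) else 0) = real (card (V \<inter> {y. act i y}))"
      using fV by (simp add: sum.If_cases)
    also have "V \<inter> {y. act i y} = {y \<in> C. act i y}" by (auto simp: V_def act_def)
    finally show "(\<Sum>y\<in>V. if act i y then 1 else 0) = real (card {y \<in> C. act i y})" .
  qed
  also have "real (card V) = real (card C) - real m"
    using assms distinct_card[of xs] card_mono[of C "set xs"] by (simp add: V_def card_Diff_subset of_nat_diff)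
  finally show ?thesis by (simp add: act_def)
qed

section \<open>Counting tuples of words\<close>

text \<open>Tuples are split by the symbol \<open>g w\<close> of their first word, which matches the
  recursion of \<open>dsum\<close> with the class sizes as weights.\<close>

lemma card_tuples_distinct_image:
  fixes g :: "'a \<Rightarrow> 'b"
  assumes "finite W" "finite S" 
  shows "real (card {xs. length xs = m \<and> set xs \<subseteq> W \<and> distinct (map g xs) \<and> g ` set xs \<subseteq> S}) =
    dsum (\<lambda>a. real (card {w \<in> W. g w = a})) m S"
  using assms(2)
proof (induction m arbitrary: S)
  case 0
  have "{xs. length xs = 0 \<and> set xs \<subseteq> W \<and> distinct (map g xs) \<and> g ` set xs \<subseteq> S} = {[]}" by auto
  then show ?case by simp
next
  case (Suc m)
  define T where "T = (\<lambda>m S. {xs. length xs = m \<and> set xs \<subseteq> W \<and> distinct (map g xs) \<and> g ` set xs \<subseteq> S})"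
  have fT: "finite (T m S)" for m S
    by (rule finite_subset[OF _ finite_lists_length_eq[OF assms(1), of m]]) (auto simp: T_def)
  let ?W = "\<lambda>a. {w \<in> W. g w = a}"
  have eq: "T (Suc m) S = (\<Union>a\<in>S. (\<lambda>(w, xs). w # xs) ` (?W a \<times> T m (S - {a})))"
  proof (intro equalityI subsetI)
    fix xs assume "xs \<in> T (Suc m) S"
    then obtain w ys where "xs = w # ys" "w \<in> W" "g w \<in> S" "ys \<in> T m (S - {g w})"
      by (cases xs) (auto simp: T_def)
    then show "xs \<in> (\<Union>a\<in>S. (\<lambda>(w, xs). w # xs) ` (?W a \<times> T m (S - {a})))" by force
  next
    fix xs assume "xs \<in> (\<Union>a\<in>S. (\<lambda>(w, xs). w # xs) ` (?W a \<times> T m (S - {a})))"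
    then show "xs \<in> T (Suc m) S" by (fastforce simp: T_def)
  qed
  have "card (T (Suc m) S) = (\<Sum>a\<in>S. card ((\<lambda>(w, xs). w # xs) ` (?W a \<times> T m (S - {a}))))"
    unfolding eq by (rule card_UN_disjoint) (use Suc.prems assms fT in auto)
  also have "\<dots> = (\<Sum>a\<in>S. card (?W a) * card (T m (S - {a})))"
    by (intro sum.cong refl) (subst card_image, auto simp: inj_on_def card_cartesian_product)
  finally show ?case using Suc by (simp add: T_def)
qed

text \<open>A crude lower bound for the falling factorial. Its form matters: once the power is
  divided out, what remains is linear in \<open>card W\<close>, so it can be summed over subcodes
  knowing only their total size.\<close>

lemma card_distinct_tuples_ge:
  assumes "finite W"
  shows "real (card {xs. length xs = Suc m \<and> set xs \<subseteq> W \<and> distinct xs}) \<ge>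
    real (card W) ^ m * (real (card W) - real (Suc m) ^ 2)"
proof -
  have *: "dsum (\<lambda>_. 1) (Suc m) S \<ge> real (card S) ^ m * (real (card S) - real (Suc m) ^ 2)"
    if "finite S" for S :: "'a set"
    using that
  proof (induction m arbitrary: S)
    case 0
    then show ?case by simp
  next
    case (Suc m)
    define N where "N = real (card S)"
    show ?case
    proof (cases "S = {}")
      case False
      then have N: "N \<ge> 1" using Suc.prems by (simp add: N_def Suc_leI card_gt_0_iff)
      have cS: "real (card (S - {a})) = N - 1" if "a \<in> S" for a
        using that N Suc.prems by (simp add: N_def card_Diff_singleton of_nat_diff)
      have "dsum (\<lambda>_. 1) (Suc (Suc m)) S \<ge> (\<Sum>a\<in>S. (N - 1) ^ m * (N - 1 - real (Suc m) ^ 2))"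
        unfolding dsum.simps(2)[of _ "Suc m"]
      proof (rule sum_mono)
        fix a assume "a \<in> S"
        then show "(N - 1) ^ m * (N - 1 - real (Suc m) ^ 2) \<le> 1 * dsum (\<lambda>_. 1) (Suc m) (S - {a})"
          using Suc.IH[of "S - {a}"] Suc.prems unfolding cS[OF \<open>a \<in> S\<close>] by simp
      qed
      then have 1: "dsum (\<lambda>_. 1) (Suc (Suc m)) S \<ge> N * ((N - 1) ^ m * (N - 1 - real (Suc m) ^ 2))"
        by (simp add: N_def)
      have nn: "dsum (\<lambda>_. 1) (Suc (Suc m)) S \<ge> 0" by (rule dsum_nonneg) simp
      show ?thesis
      proof (cases "N \<le> real (Suc (Suc m)) ^ 2")
        case True
        then have "N ^ Suc m * (N - real (Suc (Suc m)) ^ 2) \<le> 0"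
          using N by (intro mult_nonneg_nonpos) auto
        then show ?thesis using nn by (simp add: N_def[symmetric] del: dsum.simps)
      next
        case False
        \<comment> \<open>Bernoulli's inequality turns the power of \<open>N - 1\<close> from the
          induction hypothesis back into a power of \<open>N\<close>.\<close>
        have "(1 + (- 1 / N)) ^ m \<ge> 1 + real m * (- 1 / N)"
          using N by (intro Bernoulli_inequality) (auto simp: field_simps)
        then have "N ^ m * (1 - real m / N) \<le> N ^ m * (1 - 1 / N) ^ m"
          using N by (intro mult_left_mono) auto
        also have "\<dots> = (N - 1) ^ m"
          using N by (simp add: power_mult_distrib[symmetric] field_simps)
        finally have B: "N ^ m * (1 - real m / N) \<le> (N - 1) ^ m" .
        have pos: "N - 1 - real (Suc m) ^ 2 \<ge> 0" using False by (simp add: power2_eq_square algebra_simps)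
        have "N - real (Suc (Suc m)) ^ 2 \<le> (1 - real m / N) * (N - 1 - real (Suc m) ^ 2)"
          using N by (simp add: field_simps power2_eq_square)
        then have "N ^ m * (N - real (Suc (Suc m)) ^ 2) \<le> N ^ m * (1 - real m / N) * (N - 1 - real (Suc m) ^ 2)"
          using N by (simp add: mult.assoc)
        also have "\<dots> \<le> (N - 1) ^ m * (N - 1 - real (Suc m) ^ 2)"
          using B pos by (rule mult_right_mono)
        finally have "N * (N ^ m * (N - real (Suc (Suc m)) ^ 2)) \<le> N * ((N - 1) ^ m * (N - 1 - real (Suc m) ^ 2))"
          using N by (intro mult_left_mono) auto
        then show ?thesis using 1 by (simp add: N_def[symmetric] mult.assoc del: dsum.simps)
      qed
    qed simp
  qed
  have "{xs. length xs = Suc m \<and> set xs \<subseteq> W \<and> distinct xs} =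
      {xs. length xs = Suc m \<and> set xs \<subseteq> W \<and> distinct (map (\<lambda>x. x) xs) \<and> (\<lambda>x. x) ` set xs \<subseteq> W}"
    by auto
  then have "real (card {xs. length xs = Suc m \<and> set xs \<subseteq> W \<and> distinct xs}) =
      dsum (\<lambda>a. real (card {w \<in> W. w = a})) (Suc m) W"
    using card_tuples_distinct_image[OF assms assms, of "Suc m" "\<lambda>x. x"] by simp
  also have "\<dots> = dsum (\<lambda>_. 1) (Suc m) W"
  proof (rule dsum_cong)
    fix a assume "a \<in> W"
    then have "{w \<in> W. w = a} = {a}" by auto
    then show "real (card {w \<in> W. w = a}) = 1" by simp
  qed
  finally show ?thesis using *[OF assms] by simp
qed

section \<open>Averaging over subcodes\<close>

lemma finite_words: "finite (words b n)"
proof -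
  have "words b n = {w. set w \<subseteq> {1..b} \<and> length w = n}" by (auto simp: words_def)
  then show ?thesis by (simp add: finite_lists_length_eq)
qed

lemma finite_hash_code: "hash_code b k n C \<Longrightarrow> finite C"
  using finite_subset[OF _ finite_words] by (auto simp: hash_code_def)

lemma sum_card_swap:
  assumes "finite A" "finite B"
  shows "(\<Sum>a\<in>A. real (card {b \<in> B. P a b})) = (\<Sum>b\<in>B. real (card {a \<in> A. P a b}))"
proof -
  have "(\<Sum>a\<in>A. card {b \<in> B. P a b}) = (\<Sum>b\<in>B. card {a \<in> A. P a b})"
    using sum_multicount_gen[OF assms, of P "\<lambda>b. card {a \<in> A. P a b}"] by simp
  from arg_cong[OF this, of real] show ?thesis by simp
qed

lemma sum_over_fibres:
  fixes h :: "'b \<Rightarrow> real"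
  assumes "finite C" "finite S" "g ` C \<subseteq> S"
  shows "(\<Sum>y\<in>C. h (g y)) = (\<Sum>a\<in>S. real (card {y \<in> C. g y = a}) * h a)"
  using sum.group[OF assms, of "\<lambda>y. h (g y)"] by simp

text \<open>Hansel's inequality is summed over the \<open>m\<close>-tuples in a box and then over
  all boxes with sides from \<open>BB\<close>. Since \<open>BB\<close> covers each symbol
  \<open>t\<close> times, a box holds on average \<open>M * (t / card BB) ^ l\<close> words; the
  last factor on the left is the loss from tuples with repeated words.\<close>

lemma hash_code_ineq:
  fixes C :: "nat list set" and c \<kappa> :: real
  assumes code: "hash_code b (m + 2) n C" and m: "0 < m" "m < b" "m < card C" and l: "l \<le> n"
    and BB: "finite BB" "\<And>B. B \<in> BB \<Longrightarrow> finite B \<and> card B < m"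
      "\<And>a. a \<in> {1..b} \<Longrightarrow> card {B \<in> BB. a \<in> B} = t" "t > 0"
    and form: "\<And>p x. (\<And>a. a \<in> {1..b} \<Longrightarrow> p a \<ge> 0) \<Longrightarrow> sum p {1..b} = 1 \<Longrightarrow> sum x {1..b} = 1 \<Longrightarrow>
       (\<Sum>a=1..b. x a * dsum p m ({1..b} - {a})) + \<kappa> * (\<Sum>a=1..b. x a * p a)
         - \<kappa> * (\<Sum>a=1..b. (x a)\<^sup>2) \<le> c"
  defines "M \<equiv> real (card C)"
  shows "(M - m) * ln (M - m) * (1 - (real m)\<^sup>2 * (card BB / t) ^ l / M) \<le> ln (real (b - m)) * (real n - l) * c * M"
proof -
  have fC: "finite C" using code by (rule finite_hash_code)
  have M: "M \<ge> real m + 1" using m(3) by (simp add: M_def)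
  define L where "L = (M - m) * ln (M - m)"
  have L: "L \<ge> 0" using M by (simp add: L_def)
  have lnr: "ln (real (b - m)) \<ge> 0" using m(2) by simp
  define S where "S = {1..b}"
  have sym: "w ! i \<in> S" if "w \<in> C" "i < n" for w i
    using code that by (force simp: hash_code_def words_def S_def)
  define X where "X = (\<lambda>i a. real (card {y \<in> C. y ! i = a}))"
  define x where "x = (\<lambda>i a. X i a / M)"
  \<comment> \<open>\<open>\<Omega> A\<close> is the part of \<open>C\<close> in a box whose first \<open>l\<close> sides have fewer than \<open>m\<close> symbols, so
    \<open>m\<close> of them collide in each of the first \<open>l\<close> coordinates.\<close>
  define \<Omega> where "\<Omega> = (\<lambda>A :: nat \<Rightarrow> nat set. {w \<in> C. \<forall>i<l. w ! i \<in> A i})"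
  define N where "N = (\<lambda>A. real (card (\<Omega> A)))"
  define Y where "Y = (\<lambda>A i a. real (card {w \<in> \<Omega> A. w ! i = a}))"
  define Tup where "Tup = (\<lambda>A. {xs. length xs = m \<and> set xs \<subseteq> \<Omega> A})"
  define cnt where "cnt = (\<lambda>A i. \<Sum>xs\<in>Tup A. real (card {y \<in> C. distinct (map (\<lambda>w. w ! i) (y # xs))}))"
  define F where "F = PiE {..<l} (\<lambda>_. BB)"
  have f\<Omega>: "finite (\<Omega> A)" "\<Omega> A \<subseteq> C" for A using fC by (auto simp: \<Omega>_def)
  have fTup: "finite (Tup A)" for A
    using finite_lists_length_eq[OF f\<Omega>(1)[of A], of m] by (simp add: Tup_def conj_commute)
  have fF: "finite F" using BB(1) by (simp add: F_def finite_PiE)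

  have step1: "N A ^ (m - 1) * (N A - (real m)\<^sup>2) * L \<le> ln (real (b - m)) * (\<Sum>i<n. cnt A i)" for A
  proof -
    let ?D = "{xs. length xs = m \<and> set xs \<subseteq> \<Omega> A \<and> distinct xs}"
    let ?f = "\<lambda>xs. ln (real (b - m)) * (\<Sum>i<n. real (card {y \<in> C. distinct (map (\<lambda>w. w ! i) (y # xs))}))"
    have "N A ^ (m - 1) * (N A - (real m)\<^sup>2) * L \<le> real (card ?D) * L"
      using card_distinct_tuples_ge[OF f\<Omega>(1)[of A], of "m - 1"] m(1) L
      by (intro mult_right_mono) (simp_all add: N_def)
    also have "\<dots> = (\<Sum>xs\<in>?D. L)" by simp
    also have "\<dots> \<le> (\<Sum>xs\<in>?D. ?f xs)"
      using hansel_hash_code[OF code fC refl m(2)] f\<Omega>(2)[of A]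
      unfolding L_def M_def by (intro sum_mono) auto
    \<comment> \<open>Tuples with a repeated word collide in every coordinate and add nothing;
      admitting them makes the count in \<open>step2\<close> exact.\<close>
    also have "\<dots> \<le> (\<Sum>xs\<in>Tup A. ?f xs)"
      using lnr fTup[of A] by (intro sum_mono2) (auto simp: Tup_def intro!: mult_nonneg_nonneg sum_nonneg)
    also have "\<dots> = ln (real (b - m)) * (\<Sum>i<n. cnt A i)"
      unfolding cnt_def by (subst sum.swap) (simp add: sum_distrib_left)
    finally show ?thesis .
  qed

  have step2: "cnt A i = (\<Sum>a\<in>S. X i a * dsum (Y A i) m (S - {a}))" if "i < n" for A i
  proof -
    have "cnt A i = (\<Sum>y\<in>C. real (card {xs \<in> Tup A. distinct (map (\<lambda>w. w ! i) (y # xs))}))"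
      unfolding cnt_def by (rule sum_card_swap[OF fTup fC])
    also have "\<dots> = (\<Sum>y\<in>C. dsum (Y A i) m (S - {y ! i}))"
    proof (rule sum.cong[OF refl])
      fix y assume "y \<in> C"
      have "(\<lambda>w. w ! i) ` set xs \<subseteq> S" if "set xs \<subseteq> \<Omega> A" for xs
        using that f\<Omega>(2)[of A] sym[OF _ \<open>i < n\<close>] by blast
      then have "{xs \<in> Tup A. distinct (map (\<lambda>w. w ! i) (y # xs))} =
          {xs. length xs = m \<and> set xs \<subseteq> \<Omega> A \<and> distinct (map (\<lambda>w. w ! i) xs)
            \<and> (\<lambda>w. w ! i) ` set xs \<subseteq> S - {y ! i}}"
        by (intro Collect_cong) (auto simp: Tup_def subset_Diff_insert)
      then show "real (card {xs \<in> Tup A. distinct (map (\<lambda>w. w ! i) (y # xs))}) = dsum (Y A i) m (S - {y ! i})"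
        using card_tuples_distinct_image[OF f\<Omega>(1)[of A], of "S - {y ! i}" m "\<lambda>w. w ! i"]
        by (simp add: Y_def S_def)
    qed
    also have "\<dots> = (\<Sum>a\<in>S. X i a * dsum (Y A i) m (S - {a}))"
      unfolding X_def by (rule sum_over_fibres[OF fC]) (use sym that in \<open>auto simp: S_def\<close>)
    finally show ?thesis .
  qed

  have step3: "cnt A i = 0" if "A \<in> F" "i < l" for A i
  proof -
    have "A i \<in> BB" using PiE_mem[OF that(1)[unfolded F_def]] that(2) by simp
    then have Ai: "finite (A i)" "card (A i) < m" using BB(2)[of "A i"] by blast+
    have "\<not> distinct (map (\<lambda>w. w ! i) xs)" if "xs \<in> Tup A" for xs
    proof
      assume d: "distinct (map (\<lambda>w. w ! i) xs)"
      have "(\<lambda>w. w ! i) ` set xs \<subseteq> A i" using that \<open>i < l\<close> unfolding Tup_def \<Omega>_def by blast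
      from card_mono[OF Ai(1) this] have "card ((\<lambda>w. w ! i) ` set xs) < m" using Ai(2) by simp
      then show False using distinct_card[OF d] that by (simp add: Tup_def)
    qed
    then show ?thesis by (simp add: cnt_def)
  qed

  \<comment> \<open>\<open>N A\<close> times the bound that \<open>form\<close> gives for the
    \<open>x\<close>-weighted sum at \<open>p = Y A i / N A\<close>. It is linear in
    \<open>N A\<close> and \<open>Y A i\<close>, so it can be summed over boxes.\<close>
  define Z where "Z = (\<lambda>A i. c * N A - \<kappa> * (\<Sum>a\<in>S. x i a * Y A i a) + \<kappa> * N A * (\<Sum>a\<in>S. (x i a)\<^sup>2))"
  have sumX: "sum (X i) S = M" if "i < n" for i
    using sum_over_fibres[OF fC, of S "\<lambda>w. w ! i" "\<lambda>_. 1"] sym that by (force simp: X_def M_def S_def)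
  have sumY: "sum (Y A i) S = N A" if "i < n" for A i
    using sum_over_fibres[OF f\<Omega>(1)[of A], of S "\<lambda>w. w ! i" "\<lambda>_. 1"] f\<Omega>(2)[of A] sym that
    by (force simp: Y_def N_def S_def)
  have step4: "cnt A i \<le> N A ^ (m - 1) * (M * Z A i)" if "i < n" "N A > 0" for A i
  proof -
    define p where "p = (\<lambda>a. Y A i a / N A)"
    have Y: "Y A i = (\<lambda>a. N A * p a)" using that by (simp add: p_def)
    have X: "X i a = M * x i a" for a using M by (simp add: x_def)
    have "cnt A i = M * N A ^ m * (\<Sum>a\<in>S. x i a * dsum p m (S - {a}))"
      unfolding step2[OF that(1)] Y dsum_scale X by (simp add: sum_distrib_left mult_ac)
    also have "\<dots> \<le> M * N A ^ m * (c - \<kappa> * (\<Sum>a\<in>S. x i a * p a) + \<kappa> * (\<Sum>a\<in>S. (x i a)\<^sup>2))"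
    proof (rule mult_left_mono)
      have "sum p S = 1" "sum (x i) S = 1"
        using sumX[OF that(1)] sumY[OF that(1), of A] that M
        by (simp_all add: p_def x_def flip: sum_divide_distrib)
      moreover have "p a \<ge> 0" for a by (simp add: p_def Y_def N_def)
      ultimately show "(\<Sum>a\<in>S. x i a * dsum p m (S - {a})) \<le>
          c - \<kappa> * (\<Sum>a\<in>S. x i a * p a) + \<kappa> * (\<Sum>a\<in>S. (x i a)\<^sup>2)"
        using form[of p "x i"] by (simp add: S_def)
    qed (use M that in auto)
    also have "\<dots> = N A ^ (m - 1) * (M * Z A i)"
      using m(1) by (cases m) (simp_all add: Z_def Y sum_distrib_left algebra_simps)
    finally show ?thesis .
  qed

  \<comment> \<open>The common factor \<open>N A ^ (m - 1)\<close> is cancelled; an empty box is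
    treated separately.\<close>
  have step5: "(N A - (real m)\<^sup>2) * L \<le> ln (real (b - m)) * (\<Sum>i=l..<n. M * Z A i)" if "A \<in> F" for A
  proof (cases "N A > 0")
    case True
    have "(\<Sum>i<n. cnt A i) = (\<Sum>i=l..<n. cnt A i)"
      using step3[OF that] l by (intro sum.mono_neutral_right) auto
    also have "\<dots> \<le> (\<Sum>i=l..<n. N A ^ (m - 1) * (M * Z A i))"
      using True by (intro sum_mono step4) auto
    also have "\<dots> = N A ^ (m - 1) * (\<Sum>i=l..<n. M * Z A i)" by (simp add: sum_distrib_left)
    finally have "N A ^ (m - 1) * ((N A - (real m)\<^sup>2) * L) \<le>
        N A ^ (m - 1) * (ln (real (b - m)) * (\<Sum>i=l..<n. M * Z A i))"
      using step1[of A] mult_left_mono[OF _ lnr] by (fastforce simp: mult_ac)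
    then show ?thesis using True by simp
  next
    case False
    then have "\<Omega> A = {}" using f\<Omega>(1)[of A] by (auto simp: N_def card_gt_0_iff)
    then have "N A = 0" "Z A i = 0" for i by (simp_all add: N_def Y_def Z_def)
    then show ?thesis using L by simp
  qed

  have count: "(\<Sum>A\<in>F. real (card {w \<in> \<Omega> A. P w})) = real t ^ l * real (card {w \<in> C. P w})" for P
  proof -
    have "{w \<in> \<Omega> A. P w} = {w \<in> {w \<in> C. P w}. \<forall>i<l. w ! i \<in> A i}" for A by (auto simp: \<Omega>_def)
    then have "(\<Sum>A\<in>F. real (card {w \<in> \<Omega> A. P w})) =
        (\<Sum>w\<in>{w \<in> C. P w}. real (card {A \<in> F. \<forall>i<l. w ! i \<in> A i}))"
      using sum_card_swap[OF fF, of "{w \<in> C. P w}"] fC by simp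
    also have "\<dots> = (\<Sum>w\<in>{w \<in> C. P w}. real t ^ l)"
    proof (rule sum.cong[OF refl])
      fix w assume w: "w \<in> {w \<in> C. P w}"
      have "{A \<in> F. \<forall>i<l. w ! i \<in> A i} = PiE {..<l} (\<lambda>i. {B \<in> BB. w ! i \<in> B})"
        unfolding F_def PiE_iff set_eq_iff mem_Collect_eq by (metis lessThan_iff)
      moreover have "card {B \<in> BB. w ! i \<in> B} = t" if "i < l" for i
        using BB(3)[of "w ! i"] sym[of w i] w l that by (simp add: S_def)
      ultimately show "real (card {A \<in> F. \<forall>i<l. w ! i \<in> A i}) = real t ^ l"
        by (simp add: card_PiE)
    qed
    finally show ?thesis by simp
  qed
  define T where "T = real t ^ l"
  have T: "T > 0" using BB(4) by (simp add: T_def)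
  have sumN: "(\<Sum>A\<in>F. N A) = T * M" using count[of "\<lambda>_. True"] by (simp add: N_def M_def T_def)
  have sumYF: "(\<Sum>A\<in>F. Y A i a) = T * (M * x i a)" for i a
    using count[of "\<lambda>w. w ! i = a"] M by (simp add: Y_def X_def x_def T_def)
  \<comment> \<open>Every word lies in \<open>t ^ l\<close> boxes, so weighting the boxes by \<open>N A\<close> averages the frequencies
    \<open>Y A i / N A\<close> to \<open>x i\<close>; hence the \<open>\<kappa>\<close>-terms cancel.\<close>
  have sumZ: "(\<Sum>A\<in>F. Z A i) = T * M * c" for i
  proof -
    have "(\<Sum>A\<in>F. Z A i) = c * (\<Sum>A\<in>F. N A) - \<kappa> * (\<Sum>A\<in>F. \<Sum>a\<in>S. x i a * Y A i a)
       + \<kappa> * (\<Sum>A\<in>F. N A) * (\<Sum>a\<in>S. (x i a)\<^sup>2)"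
      by (simp only: Z_def sum.distrib sum_subtractf flip: sum_distrib_left sum_distrib_right)
    also have "(\<Sum>A\<in>F. \<Sum>a\<in>S. x i a * Y A i a) = (\<Sum>a\<in>S. x i a * (\<Sum>A\<in>F. Y A i a))"
      unfolding sum_distrib_left by (rule sum.swap)
    also have "\<dots> = T * M * (\<Sum>a\<in>S. (x i a)\<^sup>2)"
      by (simp add: sumYF sum_distrib_left power2_eq_square mult_ac)
    finally show ?thesis by (simp add: sumN)
  qed
  have "(\<Sum>A\<in>F. (N A - (real m)\<^sup>2) * L) \<le> (\<Sum>A\<in>F. ln (real (b - m)) * (\<Sum>i=l..<n. M * Z A i))"
    by (intro sum_mono step5)
  also have "\<dots> = ln (real (b - m)) * (\<Sum>i=l..<n. M * (\<Sum>A\<in>F. Z A i))"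
    unfolding sum_distrib_left by (rule sum.swap)
  also have "\<dots> = T * M * (ln (real (b - m)) * (real n - l) * c * M)"
    using l by (simp add: sumZ of_nat_diff)
  also have "(\<Sum>A\<in>F. (N A - (real m)\<^sup>2) * L) = T * M * (L * (1 - (real m)\<^sup>2 * (card BB / t) ^ l / M))"
  proof -
    have cF: "real (card F) = T * (card BB / t) ^ l"
      using BB(4) by (simp add: F_def card_PiE T_def power_divide)
    have "(\<Sum>A\<in>F. (N A - (real m)\<^sup>2) * L) = (T * M - real (card F) * (real m)\<^sup>2) * L"
      by (simp add: sum_subtractf sumN flip: sum_distrib_right)
    also have "\<dots> = T * M * (L * (1 - (real m)\<^sup>2 * (card BB / t) ^ l / M))"
      unfolding cF using M by (simp add: right_diff_distrib left_diff_distrib mult_ac del: power_divide)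
    finally show ?thesis .
  qed
  finally show ?thesis using T M by (simp add: L_def mult.assoc)
qed

section \<open>Bounds on the rate\<close>

lemma N_hash_attained:
  assumes "k > 0"
  obtains C where "hash_code b k n C" "card C = N_hash b k n"
proof -
  have "finite {card C | C. hash_code b k n C}"
    by (rule finite_subset[of _ "card ` Pow (words b n)"]) (auto simp: hash_code_def finite_words)
  moreover have "hash_code b k n {}" using assms by (auto simp: hash_code_def)
  then have "{card C | C. hash_code b k n C} \<noteq> {}" by blast
  ultimately have "N_hash b k n \<in> {card C | C. hash_code b k n C}"
    unfolding N_hash_def by (rule Max_in)
  then show ?thesis using that by auto
qed

text \<open>Divided by \<open>n\<close>, the left side tends to \<open>d * a\<close> and the right
  side to \<open>\<tau> * ln 2\<close>. The summand 1 allows for rounding \<open>l\<close> down to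
  an integer.\<close>

lemma eventually_counting_gap:
  fixes \<tau> z d m a :: real
  assumes "0 < \<tau>" "0 \<le> z" "z < 1" "d * a < \<tau> * ln 2"
  shows "\<forall>\<^sub>F n in sequentially. d * (real n * a + 1) <
     (1 - m / 2 powr (\<tau> * n)) * ln (2 powr (\<tau> * n) - m) * (1 - m\<^sup>2 * z ^ n)"
proof -
  have 1: "(\<lambda>n. 1 - m / 2 powr (\<tau> * real n)) \<longlonglongrightarrow> 1" using assms(1) by real_asymp
  have 2: "(\<lambda>n. ln (2 powr (\<tau> * real n) - m) / real n) \<longlonglongrightarrow> \<tau> * ln 2" using assms(1) by real_asymp
  have 3: "(\<lambda>n. 1 - m\<^sup>2 * z ^ n) \<longlonglongrightarrow> 1 - m\<^sup>2 * 0"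
    using assms by (intro tendsto_intros LIMSEQ_realpow_zero) auto
  have 4: "(\<lambda>n. d * (real n * a + 1) / real n) \<longlonglongrightarrow> d * a" by real_asymp
  have "(\<lambda>n. (1 - m / 2 powr (\<tau> * real n)) * (ln (2 powr (\<tau> * real n) - m) / real n) * (1 - m\<^sup>2 * z ^ n)
      - d * (real n * a + 1) / real n) \<longlonglongrightarrow> 1 * (\<tau> * ln 2) * (1 - m\<^sup>2 * 0) - d * a"
    by (rule tendsto_diff[OF tendsto_mult[OF tendsto_mult[OF 1 2] 3] 4])
  from order_tendstoD(1)[OF this, of 0]
  have "\<forall>\<^sub>F n in sequentially. 0 <
      (1 - m / 2 powr (\<tau> * real n)) * (ln (2 powr (\<tau> * real n) - m) / real n) * (1 - m\<^sup>2 * z ^ n)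
      - d * (real n * a + 1) / real n"
    using assms(4) by simp
  with eventually_gt_at_top[of 0] show ?thesis
    by eventually_elim (simp add: zero_less_divide_iff flip: diff_divide_distrib)
qed

text \<open>For a code larger than \<open>2 powr (\<tau> * n)\<close> take \<open>l\<close> near
  \<open>\<alpha> * n\<close>. By \<open>\<tau>1\<close> the boxes still hold exponentially many
  words on average, and by \<open>\<tau>2\<close> the remaining coordinates cannot supply what
  Hansel's inequality demands.\<close>

lemma R_hash_le:
  fixes c \<kappa> \<alpha> \<tau> :: real
  assumes m: "0 < m" "m < b"
    and BB: "finite BB" "\<And>B. B \<in> BB \<Longrightarrow> finite B \<and> card B < m"
      "\<And>a. a \<in> {1..b} \<Longrightarrow> card {B \<in> BB. a \<in> B} = t" "t > 0"
    and form: "\<And>p x. (\<And>a. a \<in> {1..b} \<Longrightarrow> p a \<ge> 0) \<Longrightarrow> sum p {1..b} = 1 \<Longrightarrow> sum x {1..b} = 1 \<Longrightarrow>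
       (\<Sum>a=1..b. x a * dsum p m ({1..b} - {a})) + \<kappa> * (\<Sum>a=1..b. x a * p a)
         - \<kappa> * (\<Sum>a=1..b. (x a)\<^sup>2) \<le> c"
    and "0 \<le> c" "0 \<le> \<alpha>" "\<alpha> \<le> 1" "0 < \<tau>"
    and \<tau>1: "(card BB / t) powr \<alpha> < 2 powr \<tau>"
    and \<tau>2: "(1 - \<alpha>) * c * ln (real (b - m)) < \<tau> * ln 2"
  shows "R_hash b (m + 2) \<le> ereal \<tau>"
proof -
  define \<beta> where "\<beta> = card BB / t"
  have "1 \<in> {1..b}" using m by simp
  then have "t \<le> card BB" using BB(1) BB(3)[of 1] card_mono[of BB "{B \<in> BB. 1 \<in> B}"] by auto
  then have \<beta>: "\<beta> \<ge> 1" using BB(4) by (simp add: \<beta>_def)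
  define z where "z = \<beta> powr \<alpha> / 2 powr \<tau>"
  have z: "0 \<le> z" "z < 1" using \<tau>1 by (simp_all add: z_def \<beta>_def)
  define d where "d = c * ln (real (b - m))"
  have d: "d \<ge> 0" "d * (1 - \<alpha>) < \<tau> * ln 2"
    using \<tau>2 \<open>0 \<le> c\<close> m(2) by (simp_all add: d_def mult_ac)
  have "\<forall>\<^sub>F n in sequentially. 2 powr (\<tau> * real n) > real m + 1"
    using \<open>0 < \<tau>\<close> by real_asymp
  moreover have "(\<lambda>n. 1 - (real m)\<^sup>2 * z ^ n) \<longlonglongrightarrow> 1 - (real m)\<^sup>2 * 0"
    using z by (intro tendsto_intros LIMSEQ_realpow_zero) auto
  from order_tendstoD(1)[OF this, of 0]
  have "\<forall>\<^sub>F n in sequentially. 1 - (real m)\<^sup>2 * z ^ n > 0" by simp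
  moreover note eventually_counting_gap[OF \<open>0 < \<tau>\<close> z d(2), of "real m"] eventually_gt_at_top[of 0]
  ultimately have "\<forall>\<^sub>F n in sequentially. ereal (log 2 (real (N_hash b (m + 2) n)) / real n) \<le> ereal \<tau>"
  proof eventually_elim
    case (elim n)
    define E where "E = 2 powr (\<tau> * real n)"
    obtain C where C: "hash_code b (m + 2) n C" "card C = N_hash b (m + 2) n"
      using N_hash_attained[of "m + 2"] by auto
    define M where "M = real (card C)"
    have "M \<le> E"
    proof (rule ccontr)
      assume "\<not> M \<le> E"
      then have M: "M > E" by simp
      have E: "E > real m + 1" using elim by (simp add: E_def)
      define l where "l = nat \<lfloor>\<alpha> * real n\<rfloor>"
      have l: "real l \<le> \<alpha> * real n" "real l \<ge> \<alpha> * real n - 1"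
        using \<open>0 \<le> \<alpha>\<close> unfolding l_def by (auto simp: of_nat_nat)
      have "\<alpha> * real n \<le> real n" using \<open>\<alpha> \<le> 1\<close> by (simp add: mult_left_le_one_le \<open>0 \<le> \<alpha>\<close>)
      then have ln: "l \<le> n" using l(1) by linarith
      have "\<beta> ^ l = \<beta> powr real l" using \<beta> by (simp add: powr_realpow)
      also have "\<dots> \<le> \<beta> powr (\<alpha> * real n)" using \<beta> l(1) by (intro powr_mono) auto
      also have "\<dots> = z ^ n * E"
      proof -
        have "(2 powr \<tau>) ^ n = E" "(\<beta> powr \<alpha>) ^ n = \<beta> powr (\<alpha> * real n)"
          using \<beta> by (simp_all add: E_def powr_powr flip: powr_realpow)
        then show ?thesis by (simp add: z_def power_divide E_def)
      qed
      finally have "\<beta> ^ l \<le> z ^ n * E" .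
      moreover have "z ^ n * E \<le> z ^ n * M" using M z by (intro mult_left_mono) auto
      ultimately have "\<beta> ^ l / M \<le> z ^ n" using M E by (simp add: field_simps)
      then have "(real m)\<^sup>2 * (\<beta> ^ l / M) \<le> (real m)\<^sup>2 * z ^ n" by (intro mult_left_mono) auto
      then have f3: "1 - (real m)\<^sup>2 * z ^ n \<le> 1 - (real m)\<^sup>2 * \<beta> ^ l / M" by simp
      have f1: "1 - real m / E \<le> (M - m) / M" 
        using M E mult_right_mono[of E M "real m"] by (simp add: field_simps)
      have f2: "ln (E - m) \<le> ln (M - m)" using M E by simp
      \<comment> \<open>All three factors are bounded below separately, which replaces the unknown
        size \<open>M\<close> by the threshold \<open>E\<close>.\<close>
      have "(1 - real m / E) * ln (E - m) * (1 - (real m)\<^sup>2 * z ^ n) \<le>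
          (M - m) / M * ln (M - m) * (1 - (real m)\<^sup>2 * \<beta> ^ l / M)"
        using E M elim by (intro mult_mono f1 f2 f3 mult_nonneg_nonneg) (auto simp: field_simps)
      also have "\<dots> = (M - m) * ln (M - m) * (1 - (real m)\<^sup>2 * \<beta> ^ l / M) / M" by simp
      also have "\<dots> \<le> ln (real (b - m)) * (real n - l) * c"
      proof -
        have "m < card C" using M E by (simp add: M_def)
        from hash_code_ineq[OF C(1) m this ln BB form]
        show ?thesis using M E by (simp add: M_def[symmetric] \<beta>_def[symmetric] pos_divide_le_eq)
      qed
      also have "\<dots> = d * (real n - l)" by (simp add: d_def)
      also have "\<dots> \<le> d * (real n * (1 - \<alpha>) + 1)"
        using d l(2) by (intro mult_left_mono) (auto simp: algebra_simps)
      finally show False using elim(3) by (simp add: E_def)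
    qed
    then have "real (N_hash b (m + 2) n) \<le> 2 powr (\<tau> * real n)" by (simp add: M_def E_def C)
    \<comment> \<open>An empty code causes no trouble because \<open>log 2 0 = 0\<close>.\<close>
    then have "log 2 (real (N_hash b (m + 2) n)) \<le> \<tau> * real n"
      using \<open>0 < \<tau>\<close> by (cases "N_hash b (m + 2) n = 0") (simp add: log_def, simp add: log_le_iff)
    then show ?case using elim by (simp add: field_simps)
  qed
  then show ?thesis unfolding R_hash_def by (rule Limsup_bounded)
qed

section \<open>The three explicit rates\<close>

lemma atLeastAtMost_1_5: "{1..5} = {1, 2, 3, 4, 5 :: nat}"
  by auto

lemma atLeastAtMost_1_6: "{1..6} = {1, 2, 3, 4, 5, 6 :: nat}"
  by auto

lemma Collect_mem_insert: "{B \<in> insert X F. P B} = (if P X then insert X {B \<in> F. P B} else {B \<in> F. P B})"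
  by auto

lemma R_hash_5_5: "R_hash 5 5 \<le> ereal 0.1689325"
proof -
  \<comment> \<open>The edges of a 5-cycle: pairs covering every symbol twice, with ratio 5/2,
    whereas disjoint pairs cannot cover five symbols.\<close>
  let ?BB = "{{1, 2}, {2, 3}, {3, 4}, {4, 5}, {5, 1}} :: nat set set"
  have card: "card ?BB = 5" by (simp add: doubleton_eq_iff)
  have t: "card {B \<in> ?BB. a \<in> B} = 2" if "a \<in> {1..5}" for a
    using that unfolding atLeastAtMost_1_5 Collect_mem_insert by (auto simp: doubleton_eq_iff)
  have "R_hash 5 (3 + 2) \<le> ereal 0.1689325"
  \<comment> \<open>\<open>\<alpha> = 1/8\<close> nearly balances the two conditions: they require
    \<open>\<tau>\<close> to exceed about 0.1652 and 0.168.\<close>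
  proof (rule R_hash_le[where BB = ?BB and t = 2 and \<kappa> = "4/5" and c = "24/125" and \<alpha> = "1/8"])
    show "(\<Sum>a=1..5. x a * dsum p 3 ({1..5} - {a})) + 4/5 * (\<Sum>a=1..5. x a * p a)
        - 4/5 * (\<Sum>a=1..5. (x a)\<^sup>2) \<le> 24/125"
      if "\<And>a::nat. a \<in> {1..5} \<Longrightarrow> p a \<ge> 0" "sum p {1..5} = 1" "sum x {1..5} = 1" for p x
      by (rule dsum_inner_le_5_3) (use that in auto)
    have "(5 / 2 :: real) powr (1 / 8) < 2 powr 0.1689325"
    proof -
      have "(5 / 2 :: real) ^ 20 < 2 ^ 27" by (simp add: power_divide)
      then have "(5 / 2 :: real) powr 20 < 2 powr 27" by (simp add: powr_numeral)
      then have "((5 / 2 :: real) powr 20) powr (1 / 160) < (2 powr 27) powr (1 / 160)"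
        by (intro powr_less_mono2) auto
      also have "\<dots> \<le> 2 powr 0.1689325" unfolding powr_powr by (intro powr_mono) auto
      finally show ?thesis unfolding powr_powr by simp
    qed
    then show "(card ?BB / real 2) powr (1 / 8) < 2 powr 0.1689325" unfolding card by simp
  qed (use t in \<open>auto simp: card_insert_if\<close>)
  then show ?thesis by simp
qed

lemma R_hash_6_5: "R_hash 6 5 \<le> ereal 0.3451130"
proof -
  let ?BB = "{{1, 2}, {3, 4}, {5, 6}} :: nat set set"
  have card: "card ?BB = 3" by (simp add: doubleton_eq_iff)
  have t: "card {B \<in> ?BB. a \<in> B} = 1" if "a \<in> {1..6}" for a
    using that unfolding atLeastAtMost_1_6 Collect_mem_insert by auto
  have log3: "ln 3 < (46 / 29) * ln (2::real)"
  proof -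
    \<comment> \<open>46/29 is a rational upper bound for the binary logarithm of 3, close enough
      for both conditions below.\<close>
    have "ln ((3::real) ^ 29) < ln (2 ^ 46)" by (subst ln_less_cancel_iff) auto
    moreover have "ln ((3::real) ^ 29) = 29 * ln 3" "ln ((2::real) ^ 46) = 46 * ln 2"
      by (subst ln_realpow; simp)+
    ultimately show ?thesis by linarith
  qed
  have "R_hash 6 (3 + 2) \<le> ereal 0.3451130"
  \<comment> \<open>The conditions balance at \<open>\<alpha> = 5/23\<close>, which 217/1000
    approximates.\<close>
  proof (rule R_hash_le[where BB = ?BB and t = 1 and \<kappa> = 1 and c = "5/18" and \<alpha> = "217/1000"])
    show "(\<Sum>a=1..6. x a * dsum p 3 ({1..6} - {a})) + 1 * (\<Sum>a=1..6. x a * p a)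
        - 1 * (\<Sum>a=1..6. (x a)\<^sup>2) \<le> 5/18"
      if "\<And>a::nat. a \<in> {1..6} \<Longrightarrow> p a \<ge> 0" "sum p {1..6} = 1" "sum x {1..6} = 1" for p x
      by (rule dsum_inner_le_6_3) (use that in auto)
    have ln2: "0 < ln (2::real)" by simp
    with log3 have "217/1000 * ln 3 < 345113/1000000 * ln (2::real)" by linarith
    then have "(3 :: real) powr (217/1000) < 2 powr (345113/1000000)" by (simp add: powr_def)
    then show "(card ?BB / real 1) powr (217/1000) < 2 powr 0.3451130" unfolding card by simp
    show "(1 - 217/1000) * (5 / 18) * ln (real (6 - 3)) < 0.3451130 * ln 2"
    proof -
      have "217500 * ln 3 < 345113 * ln (2::real)" using log3 ln2 by linarith
      then show ?thesis by simp
    qed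
  qed (use t in \<open>auto simp: card_insert_if\<close>)
  then show ?thesis by simp
qed

lemma R_hash_6_6: "R_hash 6 6 \<le> ereal (5 / 59)"
\<comment> \<open>At \<open>\<alpha> = 5/59\<close> both conditions become equalities for
  \<open>\<tau> = 5/59\<close>, since \<open>(1 - 5/59) * 5/54 = 5/59\<close>; the slack
  \<open>e\<close> makes them strict.\<close>
proof (rule ereal_le_epsilon2)
  fix e :: real assume e: "e > 0"
  let ?BB = "{{1, 2, 3}, {4, 5, 6}} :: nat set set"
  have "{1, 2, 3} \<noteq> {4, 5, 6 :: nat}" by auto
  then have card: "card ?BB = 2" by simp
  have t: "card {B \<in> ?BB. a \<in> B} = 1" if "a \<in> {1..6}" for a
    using that unfolding atLeastAtMost_1_6 Collect_mem_insert by auto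
  have "R_hash 6 (4 + 2) \<le> ereal (5 / 59 + e)"
  proof (rule R_hash_le[where BB = ?BB and t = 1 and \<kappa> = "4/9" and c = "5/54" and \<alpha> = "5/59"])
    show "(\<Sum>a=1..6. x a * dsum p 4 ({1..6} - {a})) + 4/9 * (\<Sum>a=1..6. x a * p a)
        - 4/9 * (\<Sum>a=1..6. (x a)\<^sup>2) \<le> 5/54"
      if "\<And>a::nat. a \<in> {1..6} \<Longrightarrow> p a \<ge> 0" "sum p {1..6} = 1" "sum x {1..6} = 1" for p x
      by (rule dsum_inner_le_6_4) (use that in auto)
    show "(card ?BB / real 1) powr (5 / 59) < 2 powr (5 / 59 + e)" unfolding card using e by simp
    show "(1 - 5 / 59) * (5 / 54) * ln (real (6 - 4)) < (5 / 59 + e) * ln 2"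
      using e by (simp add: distrib_right)
  qed (use t e in \<open>auto simp: card_insert_if\<close>)
  then show "R_hash 6 6 \<le> ereal (5 / 59) + ereal e" by simp
qed

theorem theorem2:
  shows "R_hash 5 5 \<le> ereal 0.1689325 \<and> R_hash 6 5 \<le> ereal 0.3451130 \<and>
         R_hash 6 6 \<le> ereal (5 / 59)"
  using R_hash_5_5 R_hash_6_5 R_hash_6_6 by blast

end
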